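(* If there exist an $(r,\lambda)$-design with $b$ blocks and $v$ points and an ordered design $OD_{\eta}(s,b)$, then there is a spanning bipartite block design SBBD$^*(s,v,N;\Lambda)$ with $N=\eta(b^2-b)$ and $$\Lambda=(\mu,\lambda_{12},\lambda_{21},\lambda_{22})=\bigl(\eta r(b-1),\ \eta\lambda(b-1),\ \eta r(r-1),\ \eta(r^2-\lambda)\bigr).$$
   Context: An $(r,\lambda)$-design is a pair $(V,\mathcal{B})$, where $V$ is a finite set of $v$ points and $\mathcal{B}=\{B_1,\dots,B_b\}$ is a collection of $b$ subsets of $V$ (blocks, repetitions allowed, block sizes not necessarily constant), such that each point lies in exactly $r$ blocks and any two distinct points lie together in exactly $\lambda$ blocks. An ordered design $OD_{\eta}(s,n)$ is an $(\eta(n^2-n))\times s$ array with entries from $\{1,\dots,n\}$ such that (1) each row consists of $s$ distinct elements ($s\le n$), and (2) in any two distinct columns, every ordered pair $(x,y)$ of distinct elements of $\{1,\dots,n\}$ appears in the same row exactly $\eta$ times. Let $K_{v_1,v_2}=(V_1,V_2;E)$ be the complete bipartite graph with $|V_1|=v_1$, $|V_2|=v_2$ and edges $e_{ij}$ ($i\in V_1$, $j\in V_2$). An SBBD$^*(v_1,v_2,N;\Lambda)$ with $\Lambda=(\mu,\lambda_{12},\lambda_{21},\lambda_{22})$ is a pair $(K_{v_1,v_2};\mathcal{B})$, where $\mathcal{B}=\{B_1,\dots,B_N\}$ is a collection (repetitions allowed) of $N$ subgraphs of $K_{v_1,v_2}$, identified with their edge sets, such that: (ii) each edge belongs to exactly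 $\mu$ of the $B_k$; (iii) any two edges $e_{ij},e_{ij'}$ with $j\ne j'$ lie together in exactly $\lambda_{12}$ of the $B_k$; (iv) any two edges $e_{ij},e_{i'j}$ with $i\neq i'$ lie together in exactly $\lambda_{21}$ of the $B_k$; (v) any two edges $e_{ij},e_{i'j'}$ with $i\ne i'$, $j\neq j'$ lie together in exactly $\lambda_{22}$ of the $B_k$. The asterisk indicates that the spanning condition (every block is incident with all points of $V_1$ and $V_2$) is not required. *)

theory Defs
  imports Main
begin

text \<open>
  Collections with repetitions allowed are families indexed by \<open>{1..b}\<close>; the values of
  the indexing function outside the index set are irrelevant.
\<close>

definition r_lambda_design ::
  "nat \<Rightarrow> nat \<Rightarrow> nat \<Rightarrow> nat \<Rightarrow> 'a set \<Rightarrow> (nat \<Rightarrow> 'a set) \<Rightarrow> bool" where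
  "r_lambda_design r l b v V B \<longleftrightarrow>
     finite V \<and> card V = v \<and>
     (\<forall>k\<in>{1..b}. B k \<subseteq> V) \<and>
     (\<forall>x\<in>V. card {k \<in> {1..b}. x \<in> B k} = r) \<and>
     (\<forall>x\<in>V. \<forall>y\<in>V. x \<noteq> y \<longrightarrow> card {k \<in> {1..b}. x \<in> B k \<and> y \<in> B k} = l)"

text \<open>
  \<open>A k c\<close> is the entry of the array in row \<open>k\<close> and column \<open>c\<close>.
\<close>

definition ordered_design :: "nat \<Rightarrow> nat \<Rightarrow> nat \<Rightarrow> (nat \<Rightarrow> nat \<Rightarrow> nat) \<Rightarrow> bool" where
  "ordered_design \<eta> s n A \<longleftrightarrow>
     s \<le> n \<and>
     (\<forall>k\<in>{1..\<eta> * (n^2 - n)}. \<forall>c\<in>{1..s}. A k c \<in> {1..n}) \<and>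
     (\<forall>k\<in>{1..\<eta> * (n^2 - n)}. inj_on (A k) {1..s}) \<and>
     (\<forall>c\<in>{1..s}. \<forall>d\<in>{1..s}. c \<noteq> d \<longrightarrow>
        (\<forall>x\<in>{1..n}. \<forall>y\<in>{1..n}. x \<noteq> y \<longrightarrow>
           card {k \<in> {1..\<eta> * (n^2 - n)}. A k c = x \<and> A k d = y} = \<eta>))"

text \<open>
  The edge \<open>e\<^sub>i\<^sub>j\<close> of the complete bipartite graph on \<open>(V1, V2)\<close> is the pair
  \<open>(i, j)\<close>, so the edge set is \<open>V1 \<times> V2\<close> and a subgraph, identified with its edge set,
  is a subset of it. The two sides are kept apart by the pair components, so \<open>V1\<close> and
  \<open>V2\<close> need not be disjoint as sets. Blocks are not required to be spanning.
\<close>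

definition SBBD_star ::
  "nat \<Rightarrow> nat \<Rightarrow> nat \<Rightarrow> nat \<times> nat \<times> nat \<times> nat \<Rightarrow>
   'a set \<Rightarrow> 'b set \<Rightarrow> (nat \<Rightarrow> ('a \<times> 'b) set) \<Rightarrow> bool" where
  "SBBD_star v1 v2 N \<Lambda> V1 V2 B \<longleftrightarrow>
     (case \<Lambda> of (\<mu>, l12, l21, l22) \<Rightarrow>
       finite V1 \<and> card V1 = v1 \<and> finite V2 \<and> card V2 = v2 \<and>
       (\<forall>k\<in>{1..N}. B k \<subseteq> V1 \<times> V2) \<and>
       (\<forall>i\<in>V1. \<forall>j\<in>V2. card {k \<in> {1..N}. (i, j) \<in> B k} = \<mu>) \<and>
       (\<forall>i\<in>V1. \<forall>j\<in>V2. \<forall>j'\<in>V2. j \<noteq> j' \<longrightarrow>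
          card {k \<in> {1..N}. (i, j) \<in> B k \<and> (i, j') \<in> B k} = l12) \<and>
       (\<forall>i\<in>V1. \<forall>i'\<in>V1. \<forall>j\<in>V2. i \<noteq> i' \<longrightarrow>
          card {k \<in> {1..N}. (i, j) \<in> B k \<and> (i', j) \<in> B k} = l21) \<and>
       (\<forall>i\<in>V1. \<forall>i'\<in>V1. \<forall>j\<in>V2. \<forall>j'\<in>V2. i \<noteq> i' \<and> j \<noteq> j' \<longrightarrow>
          card {k \<in> {1..N}. (i, j) \<in> B k \<and> (i', j') \<in> B k} = l22))"

text \<open>
  The differences \<open>r\<^sup>2 - \<lambda>\<close> and \<open>b - 1\<close> of natural numbers truncate only where the
  corresponding index of an SBBD is unconstrained or multiplied by zero: for at least two
  points \<open>\<lambda> \<le> r \<le> r\<^sup>2\<close>, and for at least one point \<open>r \<le> b\<close>.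
\<close>

lemma r_lambda_design_lambda_le:
  assumes "r_lambda_design r l b v V B" and "v \<ge> 2"
  shows "l \<le> r" and "l \<le> r^2"
proof -
  have V: "card V = v" "finite V"
    using assms(1) unfolding r_lambda_design_def by auto
  then obtain x y where xy: "x \<in> V" "y \<in> V" "x \<noteq> y"
    using assms(2) card_le_Suc0_iff_eq[of V] by fastforce
  have "card {k \<in> {1..b}. x \<in> B k \<and> y \<in> B k} \<le> card {k \<in> {1..b}. x \<in> B k}"
    by (rule card_mono) auto
  then show "l \<le> r"
    using assms(1) xy unfolding r_lambda_design_def by auto
  moreover have "r \<le> r^2"
    by (simp add: power2_eq_square)
  ultimately show "l \<le> r^2"
    by (rule order_trans)
qed

lemma r_lambda_design_r_le:
  assumes "r_lambda_design r l b v V B" and "v \<ge> 1"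
  shows "r \<le> b"
proof -
  have "V \<noteq> {}"
    using assms unfolding r_lambda_design_def by auto
  then obtain x where x: "x \<in> V"
    by blast
  have "card {k \<in> {1..b}. x \<in> B k} \<le> card {1..b}"
    by (rule card_mono) auto
  then show ?thesis
    using assms(1) x unfolding r_lambda_design_def by auto
qed

end

theory Submission
  imports Defs
begin

text \<open>
  The rows of the ordered design index the blocks: row \<open>k\<close> yields the subgraph joining column
  \<open>c\<close> to every point of the design block whose number is the entry in column \<open>c\<close>. Edge
  multiplicities then count the rows whose entries lie in the sets of block numbers through
  given points. One column takes every value \<open>\<eta> (b - 1)\<close> times, and two columns take every
  pair of distinct values \<open>\<eta>\<close> times. The definition of an ordered design says nothing about
  value frequencies when there is a single column, so in that case the array is replaced by an
  equitable one.
\<close>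

lemma card_preimage_const:
  assumes "finite K" "finite S" "\<And>x. x \<in> S \<Longrightarrow> card {k \<in> K. g k = x} = m"
  shows "card {k \<in> K. g k \<in> S} = m * card S"
proof -
  have "{k \<in> K. g k \<in> S} = (\<Union>x\<in>S. {k \<in> K. g k = x})"
    by auto
  also have "card \<dots> = (\<Sum>x\<in>S. card {k \<in> K. g k = x})"
    using assms(1,2) by (intro card_UN_disjoint) auto
  finally show ?thesis
    using assms(3) by simp
qed

text \<open>Entries of a row are distinct, so only off-diagonal pairs of \<open>S \<times> T\<close>
  can occur, each in \<open>\<eta>\<close> rows. The diagonal of \<open>S \<times> T\<close> is a
  copy of \<open>S \<inter> T\<close>, so the subtraction never truncates.\<close>

lemma ordered_design_pair_count:
  assumes od: "ordered_design \<eta> s n A" and cd: "c \<in> {1..s}" "d \<in> {1..s}" "c \<noteq> d"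
    and ST: "S \<subseteq> {1..n}" "T \<subseteq> {1..n}"
  shows "card {k \<in> {1..\<eta> * (n^2 - n)}. A k c \<in> S \<and> A k d \<in> T}
           = \<eta> * (card S * card T - card (S \<inter> T))"
proof -
  define P where "P = S \<times> T - (\<lambda>x. (x, x)) ` (S \<inter> T)"
  have fin: "finite S" "finite T"
    using ST by (auto intro: finite_subset)
  have "A k c \<in> S \<and> A k d \<in> T \<longleftrightarrow> (A k c, A k d) \<in> P" if "k \<in> {1..\<eta> * (n^2 - n)}" for k
  proof -
    have "A k c \<noteq> A k d"
      using od cd that unfolding ordered_design_def inj_on_def by blast
    then show ?thesis
      by (auto simp: P_def)
  qed
  then have "{k \<in> {1..\<eta> * (n^2 - n)}. A k c \<in> S \<and> A k d \<in> T}
      = {k \<in> {1..\<eta> * (n^2 - n)}. (A k c, A k d) \<in> P}"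
    by blast
  also have "card \<dots> = \<eta> * card P"
  proof (rule card_preimage_const)
    fix p assume "p \<in> P"
    then obtain x y where "p = (x, y)" "x \<in> {1..n}" "y \<in> {1..n}" "x \<noteq> y"
      using ST unfolding P_def by blast
    then show "card {k \<in> {1..\<eta> * (n^2 - n)}. (A k c, A k d) = p} = \<eta>"
      using od cd unfolding ordered_design_def by auto
  qed (use fin in \<open>auto simp: P_def\<close>)
  also have "card P = card S * card T - card (S \<inter> T)"
    unfolding P_def using fin
    by (subst card_Diff_subset) (auto simp: card_image inj_on_def card_cartesian_product)
  finally show ?thesis .
qed

text \<open>A second column, left unrestricted, turns the pair count into a count for one column:
  \<open>\<eta> * (1 * n - 1)\<close>.\<close>

lemma ordered_design_column_count:
  assumes od: "ordered_design \<eta> s n A" and "s \<ge> 2" and c: "c \<in> {1..s}" and x: "x \<in> {1..n}"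
  shows "card {k \<in> {1..\<eta> * (n^2 - n)}. A k c = x} = \<eta> * (n - 1)"
proof -
  obtain d where d: "d \<in> {1..s}" "c \<noteq> d"
    using that[of "if c = 1 then 2 else 1"] \<open>s \<ge> 2\<close> by (simp split: if_splits)
  have "{k \<in> {1..\<eta> * (n^2 - n)}. A k c = x}
      = {k \<in> {1..\<eta> * (n^2 - n)}. A k c \<in> {x} \<and> A k d \<in> {1..n}}"
    using od d unfolding ordered_design_def by auto
  then show ?thesis
    using ordered_design_pair_count[OF od c d, of "{x}" "{1..n}"] x by simp
qed

text \<open>With at most one column, injectivity of rows and the pair condition are vacuous, so any
  array with entries in range is an ordered design and the frequencies can be chosen freely.\<close>

lemma equitable_ordered_design_exists:
  assumes od: "ordered_design \<eta> s n A"
  obtains A' where "ordered_design \<eta> s n A'"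
    and "\<And>c x. c \<in> {1..s} \<Longrightarrow> x \<in> {1..n} \<Longrightarrow>
           card {k \<in> {1..\<eta> * (n^2 - n)}. A' k c = x} = \<eta> * (n - 1)"
proof (cases "s \<ge> 2")
  case True
  then show ?thesis
    using that od ordered_design_column_count by blast
next
  case False
  define m where "m = \<eta> * (n - 1)"
  \<comment> \<open>The \<open>n * m\<close> rows are cut into \<open>n\<close> consecutive runs of
    length \<open>m\<close>, the \<open>x\<close>-th run carrying the value \<open>x\<close>. The
    shifts by 1 arise because rows and values are both numbered from 1. For \<open>m = 0\<close>
    there are no rows.\<close>
  define A' :: "nat \<Rightarrow> nat \<Rightarrow> nat" where "A' = (\<lambda>k c. (k - 1) div m + 1)"
  have N: "\<eta> * (n^2 - n) = n * m"
    by (simp add: m_def power2_eq_square algebra_simps)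
  have range: "A' k c \<in> {1..n}" if k: "k \<in> {1..n * m}" for k c
  proof -
    have "(k - 1) div m < n"
      using k by (intro less_mult_imp_div_less) auto
    then show ?thesis
      by (simp add: A'_def)
  qed
  have "ordered_design \<eta> s n A'"
    using od False range unfolding ordered_design_def N by (auto simp: inj_on_def)
  moreover have "card {k \<in> {1..n * m}. A' k c = x} = m" if x: "x \<in> {1..n}" for c x
  proof (cases "m = 0")
    case False
    obtain y where y: "x = Suc y" "y < n"
      using x by (cases x) auto
    have eq: "A' k c = x \<longleftrightarrow> y * m \<le> k - 1 \<and> k - 1 < Suc y * m" for k
    proof -
      have "A' k c = x \<longleftrightarrow> y \<le> (k - 1) div m \<and> (k - 1) div m < Suc y"
        unfolding A'_def y(1) by linarith
      then show ?thesis
        using False by (simp only: less_eq_div_iff_mult_less_eq div_less_iff_less_mult)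
    qed
    have le: "Suc y * m \<le> n * m"
      using y by (intro mult_le_mono1) simp
    have "k \<in> {1..n * m} \<and> A' k c = x \<longleftrightarrow> k \<in> {y * m + 1..y * m + m}" for k
      using eq[of k] le unfolding atLeastAtMost_iff mult_Suc by arith
    then have "{k \<in> {1..n * m}. A' k c = x} = {y * m + 1..y * m + m}"
      by blast
    then show ?thesis
      by simp
  qed simp
  ultimately show ?thesis
    using that[of A'] unfolding N m_def by blast
qed

theorem theorem4p6:
  fixes r l b v \<eta> s :: nat
  assumes "\<exists>(V :: 'a set) B. r_lambda_design r l b v V B"
    and "\<exists>A. ordered_design \<eta> s b A"
  shows "\<exists>(V1 :: nat set) (V2 :: nat set) \<B>.
           SBBD_star s v (\<eta> * (b^2 - b))
             (\<eta> * r * (b - 1), \<eta> * l * (b - 1), \<eta> * r * (r - 1), \<eta> * (r^2 - l))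
             V1 V2 \<B>"
proof -
  obtain V :: "'a set" and B where des: "r_lambda_design r l b v V B"
    using assms(1) by blast
  obtain A where od: "ordered_design \<eta> s b A"
    and col: "\<And>c x. c \<in> {1..s} \<Longrightarrow> x \<in> {1..b} \<Longrightarrow>
                card {k \<in> {1..\<eta> * (b^2 - b)}. A k c = x} = \<eta> * (b - 1)"
    using assms(2) equitable_ordered_design_exists by blast
  have "finite V" "card V = v"
    using des unfolding r_lambda_design_def by auto
  then obtain f where f: "bij_betw f {0..<v} V"
    using ex_bij_betw_nat_finite by blast
  define K where "K = {1..\<eta> * (b^2 - b)}"
  \<comment> \<open>This is the dual of the design: points become sets of block numbers, of size
    \<open>r\<close> and with pairwise intersections of size \<open>l\<close>.\<close>
  define S where "S = (\<lambda>j. {m \<in> {1..b}. f j \<in> B m})"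
  define \<B> where "\<B> = (\<lambda>k. {(c, j). c \<in> {1..s} \<and> j \<in> {0..<v} \<and> A k c \<in> S j})"
  have S_sub: "S j \<subseteq> {1..b}" for j
    by (auto simp: S_def)
  have S_card: "card (S j) = r" if "j \<in> {0..<v}" for j
    using des bij_betwE[OF f] that unfolding r_lambda_design_def S_def by blast
  have S_Int: "card (S j \<inter> S j') = l" if "j \<in> {0..<v}" "j' \<in> {0..<v}" "j \<noteq> j'" for j j'
  proof -
    have "f j \<noteq> f j'"
      using f that by (auto simp: bij_betw_def inj_on_def)
    moreover have "S j \<inter> S j' = {m \<in> {1..b}. f j \<in> B m \<and> f j' \<in> B m}"
      by (auto simp: S_def)
    ultimately show ?thesis
      using des bij_betwE[OF f] that unfolding r_lambda_design_def by auto
  qed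
  have one: "card {k \<in> K. A k c \<in> T} = \<eta> * (b - 1) * card T"
    if "c \<in> {1..s}" "T \<subseteq> {1..b}" for c T
    using that col unfolding K_def
    by (intro card_preimage_const) (auto intro: finite_subset)
  have two: "card {k \<in> K. A k c \<in> S j \<and> A k c' \<in> S j'}
               = \<eta> * (card (S j) * card (S j') - card (S j \<inter> S j'))"
    if "c \<in> {1..s}" "c' \<in> {1..s}" "c \<noteq> c'" for c c' j j'
    unfolding K_def by (rule ordered_design_pair_count[OF od that S_sub S_sub])
  have edge: "(c, j) \<in> \<B> k \<longleftrightarrow> A k c \<in> S j" if "c \<in> {1..s}" "j \<in> {0..<v}" for c j k
    using that by (simp add: \<B>_def)
  have "SBBD_star s v (\<eta> * (b^2 - b))
          (\<eta> * r * (b - 1), \<eta> * l * (b - 1), \<eta> * r * (r - 1), \<eta> * (r^2 - l))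
          {1..s} {0..<v} \<B>"
    unfolding SBBD_star_def prod.case K_def[symmetric]
  proof (intro conjI ballI impI)
    show "\<B> k \<subseteq> {1..s} \<times> {0..<v}" for k
      by (auto simp: \<B>_def)
  next
    fix i j assume ij: "i \<in> {1..s}" "j \<in> {0..<v}"
    show "card {k \<in> K. (i, j) \<in> \<B> k} = \<eta> * r * (b - 1)"
      using one[OF ij(1) S_sub] S_card[OF ij(2)] by (simp only: edge[OF ij] ac_simps)
  next
    fix i j j' assume ij: "i \<in> {1..s}" "j \<in> {0..<v}" "j' \<in> {0..<v}" "j \<noteq> j'"
    \<comment> \<open>Both edges are decided by the same entry \<open>A k i\<close>, so the count
      for one column applies to the intersection.\<close>
    have "card {k \<in> K. A k i \<in> S j \<inter> S j'} = \<eta> * (b - 1) * l"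
      using one[OF ij(1), of "S j \<inter> S j'"] S_sub S_Int[OF ij(2-4)] by auto
    then show "card {k \<in> K. (i, j) \<in> \<B> k \<and> (i, j') \<in> \<B> k} = \<eta> * l * (b - 1)"
      by (simp only: edge[OF ij(1,2)] edge[OF ij(1,3)] Int_iff ac_simps)
  next
    fix i i' j assume ij: "i \<in> {1..s}" "i' \<in> {1..s}" "j \<in> {0..<v}" "i \<noteq> i'"
    show "card {k \<in> K. (i, j) \<in> \<B> k \<and> (i', j) \<in> \<B> k} = \<eta> * r * (r - 1)"
      \<comment> \<open>Here both sets are \<open>S j\<close>, whose intersection with itself has
        size \<open>r\<close>, giving \<open>r * r - r\<close>.\<close>
      using two[OF ij(1,2,4), of j j] S_card[OF ij(3)]
      by (simp add: edge[OF ij(1,3)] edge[OF ij(2,3)] diff_mult_distrib2 mult.assoc)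
  next
    fix i i' j j'
    assume ij: "i \<in> {1..s}" "i' \<in> {1..s}" "j \<in> {0..<v}" "j' \<in> {0..<v}" "i \<noteq> i' \<and> j \<noteq> j'"
    show "card {k \<in> K. (i, j) \<in> \<B> k \<and> (i', j') \<in> \<B> k} = \<eta> * (r^2 - l)"
      using two[OF ij(1,2) conjunct1[OF ij(5)], of j j']
      by (simp only: edge[OF ij(1,3)] edge[OF ij(2,4)] S_card[OF ij(3)] S_card[OF ij(4)]
          S_Int[OF ij(3,4) conjunct2[OF ij(5)]] power2_eq_square)
  qed auto
  then show ?thesis
    by blast
qed

end
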